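(* If $\mathcal{P}$ is an order-hereditary property of vertex $k$-colourings of the hypercubes $Q_n$, with $\mathcal{P}_n\ne\emptyset$ for every $n$, then $$|\mathcal{P}_n|=k^{\left(\pi_v^{\mathbf{Q}}(\mathcal{P})+o(1)\right)2^n}\qquad(n\to\infty).$$
   Context: $k\ge2$ is a fixed integer, $[k]=\{1,\dots,k\}$, and $Q_n$ denotes the $n$-dimensional hypercube with vertex set $\{0,1\}^n$. For $m\le n$, an order-preserving embedding of $Q_m$ into $Q_n$ is a map $\phi:\{0,1\}^m\to\{0,1\}^n$ for which there is an $m$-set $B=\{b_1<\dots<b_m\}\subseteq[n]$ such that $\phi(\mathbf{x})_{b_j}=\mathbf{x}_j$ for all $j$, and $\phi(\mathbf{x})_i=\phi(\mathbf{0})_i$ for $i\notin B$. An order-hereditary property of vertex $k$-colourings of hypercubes is a sequence $\mathcal{P}=(\mathcal{P}_n)_n$, where $\mathcal{P}_n$ is a set of maps $c:\{0,1\}^n\to[k]$, such that $c\circ\phi\in\mathcal{P}_m$ for every $c\in\mathcal{P}_n$ and every order-preserving embedding $\phi:Q_m\to Q_n$. A vertex template for $Q_n$ is a function $t$ assigning to each $\mathbf{x}\in\{0,1\}^n$ a nonempty set $t(\mathbf{x})\subseteq[k]$; $\langle t\rangle$ is the set of $c:\{0,1\}^n\to[k]$ with $c(\mathbf{x})\in t(\mathbf{x})$ for all $\mathbf{x}$; $\mathrm{Ent}(t)=\sum_{\mathbf{x}}\log_k|t(\mathbf{x})|$. $\mathrm{ex}(Q_n,\mathcal{P})=\max\{\mathrm{Ent}(t):\langle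 t\rangle\subseteq\mathcal{P}_n\}$, and $\pi_v^{\mathbf{Q}}(\mathcal{P})=\lim_{n\to\infty}\mathrm{ex}(Q_n,\mathcal{P})/2^n$ (the limit exists). *)

theory Defs
  imports Complex_Main "HOL-Library.FuncSet" "HOL-Library.Landau_Symbols"
begin

text \<open>
  Functions on finite sets are represented as extensional functions (\<open>\<rightarrow>\<^sub>E\<close>), so that equality
  and cardinality of sets of vertices, colourings and templates are the intended ones.
\<close>

definition cube :: "nat \<Rightarrow> (nat \<Rightarrow> nat) set" where
  "cube n = {1..n} \<rightarrow>\<^sub>E {0, 1}"

definition zero_vertex :: "nat \<Rightarrow> nat \<Rightarrow> nat" where
  "zero_vertex n = (\<lambda>i\<in>{1..n}. 0)"

text \<open>
  The set \<open>B = {b\<^sub>1 < \<dots> < b\<^sub>m}\<close> is given by its increasing enumeration \<open>b\<close>.  Only the values of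
  \<open>\<phi>\<close> on \<open>cube m\<close> matter.
\<close>
definition order_preserving_embedding ::
  "nat \<Rightarrow> nat \<Rightarrow> ((nat \<Rightarrow> nat) \<Rightarrow> (nat \<Rightarrow> nat)) \<Rightarrow> bool" where
  "order_preserving_embedding m n \<phi> \<longleftrightarrow>
     \<phi> \<in> cube m \<rightarrow> cube n \<and>
     (\<exists>b. strict_mono_on {1..m} b \<and> b ` {1..m} \<subseteq> {1..n} \<and>
       (\<forall>x\<in>cube m.
          (\<forall>j\<in>{1..m}. \<phi> x (b j) = x j) \<and>
          (\<forall>i\<in>{1..n} - b ` {1..m}. \<phi> x i = \<phi> (zero_vertex m) i)))"

definition colourings :: "nat \<Rightarrow> nat \<Rightarrow> ((nat \<Rightarrow> nat) \<Rightarrow> nat) set" where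
  "colourings k n = cube n \<rightarrow>\<^sub>E {1..k}"

definition order_hereditary :: "nat \<Rightarrow> (nat \<Rightarrow> ((nat \<Rightarrow> nat) \<Rightarrow> nat) set) \<Rightarrow> bool" where
  "order_hereditary k P \<longleftrightarrow>
     (\<forall>n. P n \<subseteq> colourings k n) \<and>
     (\<forall>m n \<phi> c. m \<le> n \<longrightarrow> order_preserving_embedding m n \<phi> \<longrightarrow> c \<in> P n \<longrightarrow>
        compose (cube m) c \<phi> \<in> P m)"

definition templates :: "nat \<Rightarrow> nat \<Rightarrow> ((nat \<Rightarrow> nat) \<Rightarrow> nat set) set" where
  "templates k n = cube n \<rightarrow>\<^sub>E {A. A \<subseteq> {1..k} \<and> A \<noteq> {}}"

definition realisations ::
  "nat \<Rightarrow> nat \<Rightarrow> ((nat \<Rightarrow> nat) \<Rightarrow> nat set) \<Rightarrow> ((nat \<Rightarrow> nat) \<Rightarrow> nat) set" where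
  "realisations k n t = {c \<in> colourings k n. \<forall>x\<in>cube n. c x \<in> t x}"

definition Ent :: "nat \<Rightarrow> nat \<Rightarrow> ((nat \<Rightarrow> nat) \<Rightarrow> nat set) \<Rightarrow> real" where
  "Ent k n t = (\<Sum>x\<in>cube n. log (real k) (real (card (t x))))"

definition exQ :: "nat \<Rightarrow> (nat \<Rightarrow> ((nat \<Rightarrow> nat) \<Rightarrow> nat) set) \<Rightarrow> nat \<Rightarrow> real" where
  "exQ k P n = Max {Ent k n t | t. t \<in> templates k n \<and> realisations k n t \<subseteq> P n}"

definition entropy_density :: "nat \<Rightarrow> (nat \<Rightarrow> ((nat \<Rightarrow> nat) \<Rightarrow> nat) set) \<Rightarrow> real" where
  "entropy_density k P = lim (\<lambda>n. exQ k P n / 2 ^ n)"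

end

theory Submission
  imports Defs "HOL-Analysis.Convex"
begin

text \<open>
  Let $h_n = \log_k |P_n| / 2^n$.  No containers are needed: one tensorises a weighted count.
  For fixed $m$ and $\eta > 0$ there is an exponent $c < 1$ such that all weights $f_y \ge 0$ satisfy
  \[ \sum_{\omega \in P_m} \prod_{y \in Q_m} f_y(\omega_y)^c
     \le k^{(1-c)(\mathrm{ex}(Q_m, P) + \eta)} \prod_{y \in Q_m} \Bigl(\sum_a f_y(a)\Bigr)^c . \]
  Such an inequality is multiplicative over independent copies, one for each vertex of $Q_n$.  Regarding
  a colouring of $Q_{n+m}$ as $2^n$ colourings of copies of $Q_m$ and, simultaneously, as $2^m$
  colourings of copies of $Q_n$, and weighting each of the latter by the indicator of $P_n$, one gets
  $h_{n+m} \le (1-c)(\mathrm{ex}(Q_m, P) + \eta)/2^m + c\,h_n$.  As $h_n$ decreases to a limit $h$, this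
  gives $h \le \mathrm{ex}(Q_m, P)/2^m \le h_m$ for every $m$.
\<close>

section \<open>The weighted inequality for a single copy of the cube\<close>

lemma weighted_geom_mean:
  fixes x y :: real
  assumes "\<alpha> \<ge> 0" "\<beta> \<ge> 0" "\<alpha> + \<beta> = 1" "x \<ge> 0" "y \<ge> 0"
  shows "x powr \<alpha> * y powr \<beta> \<le> \<alpha> * x + \<beta> * y"
proof (cases "x = 0 \<or> y = 0")
  case True
  then show ?thesis using assms by auto
next
  case False
  then show ?thesis using assms by (intro Youngs_inequality_0) auto
qed

text \<open>By concavity, total mass 1 spread over \<open>T\<close> gives at most
  \<open>card T powr (1 - c)\<close>. The values of weight at most \<open>\<gamma>\<close> enter
  only through an error that itself carries the factor \<open>1 - c\<close>, so it remains small
  relative to the main exponent even as \<open>c\<close> tends to 1. With \<open>T = A\<close> and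
  \<open>\<gamma> = 0\<close> this is the plain power mean bound.\<close>

lemma sum_powr_le:
  fixes f :: "'a \<Rightarrow> real"
  assumes A: "finite A" and f0: "\<And>a. a \<in> A \<Longrightarrow> f a \<ge> 0" and f1: "sum f A = 1"
    and c: "1/2 \<le> c" "c < 1" and \<gamma>: "\<gamma> \<ge> 0"
    and T: "T \<subseteq> A" "T \<noteq> {}" and small: "\<And>a. a \<in> A - T \<Longrightarrow> f a \<le> \<gamma>"
  shows "(\<Sum>a\<in>A. f a powr c)
    \<le> real (card T) powr (1 - c) * (1 + (1 - c) * (2 * real (card A) * sqrt \<gamma>))"
proof -
  define N where "N = real (card T)"
  have N: "N \<ge> 1"
    using T A unfolding N_def
    by (metis One_nat_def Suc_leI card_gt_0_iff finite_subset of_nat_1 of_nat_mono)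
  then have K: "N powr (1 - c) \<ge> 1"
    using c by (intro ge_one_powr_ge_zero) auto
  \<comment> \<open>Each term is bounded by an affine function of \<open>f a\<close>, so that
    \<open>f1\<close> evaluates the sum. On \<open>T\<close> this compares \<open>f a\<close> with
    the uniform weight \<open>1 / N\<close>.\<close>
  have "f a powr c \<le> N powr (1 - c) * (c * f a + (1 - c) * (if a \<in> T then 1 / N else 2 * sqrt \<gamma>))"
    if a: "a \<in> A" for a
  proof (cases "a \<in> T")
    case True
    have "f a powr c = N powr (1 - c) * (f a powr c * (1 / N) powr (1 - c))"
      using N by (simp add: powr_divide)
    also have "f a powr c * (1 / N) powr (1 - c) \<le> c * f a + (1 - c) * (1 / N)"
      using weighted_geom_mean[of c "1 - c" "f a" "1 / N"] f0[OF a] N c by simp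
    finally show ?thesis
      using True N by simp
  next
    case False
    \<comment> \<open>Interpolating between \<open>f a\<close> and its square root puts weight
      \<open>2 - 2 * c\<close> on the square root; this is the source of the factor
      \<open>1 - c\<close> and of the 2 in the bound. The assumption \<open>1/2 \<le> c\<close>
      keeps the other weight nonnegative.\<close>
    have "f a powr c = f a powr (2 * c - 1) * sqrt (f a) powr (1 - (2 * c - 1))"
      using f0[OF a] by (cases "f a = 0") (simp_all add: powr_half_sqrt[symmetric] powr_powr powr_add[symmetric] field_simps)
    also have "\<dots> \<le> (2 * c - 1) * f a + (1 - (2 * c - 1)) * sqrt (f a)"
      using weighted_geom_mean[of "2 * c - 1" "1 - (2 * c - 1)" "f a" "sqrt (f a)"] f0[OF a] c by simp
    also have "\<dots> \<le> c * f a + (2 - 2 * c) * sqrt \<gamma>"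
      using f0[OF a] c small[of a] a False by (intro add_mono mult_mono mult_right_mono) auto
    also have "\<dots> = c * f a + (1 - c) * (2 * sqrt \<gamma>)"
      by (simp add: algebra_simps)
    also have "\<dots> \<le> N powr (1 - c) * (c * f a + (1 - c) * (2 * sqrt \<gamma>))"
      using mult_right_mono[OF K, of "c * f a + (1 - c) * (2 * sqrt \<gamma>)"] f0[OF a] c \<gamma> by simp
    finally show ?thesis
      using False by simp
  qed
  then have "(\<Sum>a\<in>A. f a powr c) \<le>
      N powr (1 - c) * (\<Sum>a\<in>A. c * f a + (1 - c) * (if a \<in> T then 1 / N else 2 * sqrt \<gamma>))"
    unfolding sum_distrib_left by (rule sum_mono)
  also have "(\<Sum>a\<in>A. c * f a + (1 - c) * (if a \<in> T then 1 / N else 2 * sqrt \<gamma>))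
      = c + (1 - c) * (\<Sum>a\<in>A. if a \<in> T then 1 / N else 2 * sqrt \<gamma>)"
    using f1 by (simp add: sum.distrib flip: sum_distrib_left)
  also have "(\<Sum>a\<in>A. if a \<in> T then 1 / N else 2 * sqrt \<gamma>)
      = 1 + real (card (A - T)) * (2 * sqrt \<gamma>)"
    using A T N by (simp add: sum.If_cases Int_absorb1 Diff_eq[symmetric] N_def)
  also have "N powr (1 - c) * (c + (1 - c) * (1 + real (card (A - T)) * (2 * sqrt \<gamma>)))
      \<le> N powr (1 - c) * (1 + (1 - c) * (real (card A) * (2 * sqrt \<gamma>)))"
  proof (intro mult_left_mono)
    have "(1 - c) * (real (card (A - T)) * (2 * sqrt \<gamma>)) \<le> (1 - c) * (real (card A) * (2 * sqrt \<gamma>))"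
      using A \<gamma> c by (intro mult_left_mono mult_right_mono) (auto intro: card_mono)
    then show "c + (1 - c) * (1 + real (card (A - T)) * (2 * sqrt \<gamma>))
        \<le> 1 + (1 - c) * (real (card A) * (2 * sqrt \<gamma>))"
      by (simp add: algebra_simps)
  qed auto
  finally show ?thesis
    by (simp add: N_def mult_ac)
qed

text \<open>
  Let \<open>t y\<close> consist of the values of weight at least \<open>\<gamma>\<close>.  If the box spanned by \<open>t\<close> lies in
  \<open>S\<close>, then the values of small weight cost only a factor \<open>exp ((1 - c) * \<eta>)\<close>; otherwise a point of
  weight at least \<open>\<gamma> ^ card Y\<close> is missing from \<open>S\<close>, which pushes the sum below \<open>1\<close> once \<open>c\<close> is
  close to \<open>1\<close>.
\<close>
lemma weighted_count_le_normalised: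
  fixes A :: "'a set" and Y :: "'y set" and S :: "('y \<Rightarrow> 'a) set" and E \<eta> :: real
  assumes A: "finite A" "A \<noteq> {}" and Y: "finite Y" and S: "S \<subseteq> (Y \<rightarrow>\<^sub>E A)"
    and E0: "E \<ge> 0"
    and E: "\<And>t. t \<in> Y \<rightarrow>\<^sub>E (Pow A - {{}}) \<Longrightarrow> PiE Y t \<subseteq> S \<Longrightarrow> real (\<Prod>y\<in>Y. card (t y)) \<le> exp E"
    and \<eta>: "\<eta> > 0"
  obtains c where "0 < c" "c < 1"
    "\<And>f. (\<And>y a. y \<in> Y \<Longrightarrow> a \<in> A \<Longrightarrow> f y a \<ge> (0 :: real)) \<Longrightarrow> (\<And>y. y \<in> Y \<Longrightarrow> (\<Sum>a\<in>A. f y a) = 1) \<Longrightarrow>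
      (\<Sum>\<omega>\<in>S. \<Prod>y\<in>Y. f y (\<omega> y) powr c) \<le> exp ((1 - c) * (E + \<eta>))"
proof -
  define K where "K = real (card A)"
  define M where "M = real (card Y)"
  have K: "K \<ge> 1"
    using A unfolding K_def by (metis One_nat_def Suc_leI card_gt_0_iff of_nat_1 of_nat_mono)
  have M: "M \<ge> 0" by (simp add: M_def)
  \<comment> \<open>The bound \<open>1 / K\<close> forces every \<open>y\<close> to have a value of
    weight at least \<open>\<gamma>\<close>, since the \<open>K\<close> weights sum to 1. The second
    bound keeps the total cost of small values, \<open>M * (2 * K * sqrt \<gamma>)\<close>, below
    \<open>\<eta>\<close>; the \<open>+ 1\<close> covers empty \<open>Y\<close>.\<close>
  define \<gamma> where "\<gamma> = min (1 / K) ((\<eta> / (2 * K * M + 1))\<^sup>2)"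
  have \<gamma>: "\<gamma> > 0" "\<gamma> \<le> 1 / K"
    using K M \<eta> by (auto simp: \<gamma>_def add_nonneg_eq_0_iff)
  have "sqrt \<gamma> \<le> sqrt ((\<eta> / (2 * K * M + 1))\<^sup>2)"
    unfolding \<gamma>_def by (intro real_sqrt_le_mono) simp
  also have "\<dots> = \<eta> / (2 * K * M + 1)"
    using K M \<eta> by (simp add: add_nonneg_nonneg)
  finally have "sqrt \<gamma> * (2 * K * M + 1) \<le> \<eta>"
    using K M by (simp add: pos_le_divide_eq add_nonneg_pos)
  moreover have "sqrt \<gamma> \<ge> 0" using \<gamma> by simp
  ultimately have \<gamma>\<eta>: "M * (2 * K * sqrt \<gamma>) \<le> \<eta>"
    by (simp add: algebra_simps del: real_sqrt_ge_0_iff)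
  \<comment> \<open>The bound 1/2 is what \<open>sum_powr_le\<close> requires. The other one makes
    the trivial bound \<open>K powr (1 - c)\<close> per point of \<open>Y\<close> multiply up to at
    most \<open>1 + \<gamma> ^ card Y\<close>, an excess that one missing point can pay for; the
    \<open>+ 1\<close> covers \<open>M * ln K = 0\<close>.\<close>
  define \<delta> where "\<delta> = min (1/2) (ln (1 + \<gamma> ^ card Y) / (M * ln K + 1))"
  define c where "c = 1 - \<delta>"
  have L: "ln (1 + \<gamma> ^ card Y) > 0" "M * ln K \<ge> 0"
    using \<gamma> K M by (simp_all add: ln_gt_zero)
  have "\<delta> > 0"
    using L by (simp add: \<delta>_def add_nonneg_pos)
  moreover have "\<delta> \<le> 1/2"
    unfolding \<delta>_def by (rule min.cobounded1)
  ultimately have \<delta>: "\<delta> > 0" "\<delta> \<le> 1/2"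
    by auto
  have "\<delta> \<le> ln (1 + \<gamma> ^ card Y) / (M * ln K + 1)"
    by (simp add: \<delta>_def)
  then have "\<delta> * (M * ln K + 1) \<le> ln (1 + \<gamma> ^ card Y)"
    using L by (simp add: pos_le_divide_eq)
  then have "\<delta> * (M * ln K) \<le> ln (1 + \<gamma> ^ card Y)"
    using \<delta> by (simp add: algebra_simps)
  then have "exp (\<delta> * (M * ln K)) \<le> 1 + \<gamma> ^ card Y"
    using \<gamma> by (metis add_pos_pos exp_le_cancel_iff exp_ln zero_less_one zero_less_power)
  moreover have "exp (\<delta> * (M * ln K)) = (\<Prod>y\<in>Y. K powr (1 - c))"
    using K by (simp add: c_def powr_def M_def exp_of_nat_mult[symmetric] mult_ac)
  ultimately have loss: "(\<Prod>y\<in>Y. K powr (1 - c)) \<le> 1 + \<gamma> ^ card Y" by simp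
  have c: "1/2 \<le> c" "c < 1" using \<delta> by (auto simp: c_def)
  show ?thesis
  proof (rule that[of c])
    show "0 < c" "c < 1" using c by auto
  next
    fix f :: "'y \<Rightarrow> 'a \<Rightarrow> real"
    assume f0: "\<And>y a. y \<in> Y \<Longrightarrow> a \<in> A \<Longrightarrow> f y a \<ge> 0"
      and f1: "\<And>y. y \<in> Y \<Longrightarrow> (\<Sum>a\<in>A. f y a) = 1"
    define t where "t = (\<lambda>y\<in>Y. {a \<in> A. f y a \<ge> \<gamma>})"
    have ne: "{a \<in> A. f y a \<ge> \<gamma>} \<noteq> {}" if y: "y \<in> Y" for y
    proof
      assume "{a \<in> A. f y a \<ge> \<gamma>} = {}"
      then have "(\<Sum>a\<in>A. f y a) < (\<Sum>a\<in>A. 1 / K)"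
        using A \<gamma> by (intro sum_strict_mono) force+
      then show False using f1[OF y] K by (simp add: K_def)
    qed
    then have t: "t \<in> Y \<rightarrow>\<^sub>E (Pow A - {{}})"
      by (auto simp: t_def)
    show "(\<Sum>\<omega>\<in>S. \<Prod>y\<in>Y. f y (\<omega> y) powr c) \<le> exp ((1 - c) * (E + \<eta>))"
    proof (cases "PiE Y t \<subseteq> S")
      case True
      have finPi: "finite (Y \<rightarrow>\<^sub>E A)" using A Y by (simp add: finite_PiE)
      have "(\<Sum>\<omega>\<in>S. \<Prod>y\<in>Y. f y (\<omega> y) powr c) \<le> (\<Sum>\<omega>\<in>Y \<rightarrow>\<^sub>E A. \<Prod>y\<in>Y. f y (\<omega> y) powr c)"
        using S finPi by (intro sum_mono2) (auto intro!: prod_nonneg)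
      also have "\<dots> = (\<Prod>y\<in>Y. \<Sum>a\<in>A. f y a powr c)"
        using A Y by (simp add: prod_sum_PiE)
      also have "\<dots> \<le> (\<Prod>y\<in>Y. real (card (t y)) powr (1 - c) * (1 + (1 - c) * (2 * K * sqrt \<gamma>)))"
      proof (rule prod_mono, intro conjI)
        fix y assume y: "y \<in> Y"
        show "(\<Sum>a\<in>A. f y a powr c) \<le> real (card (t y)) powr (1 - c) * (1 + (1 - c) * (2 * K * sqrt \<gamma>))"
          unfolding K_def
          using A f0[OF y] f1[OF y] c \<gamma> ne[OF y] y
          by (intro sum_powr_le) (auto simp: t_def)
      qed (auto intro: sum_nonneg)
      also have "\<dots> = (\<Prod>y\<in>Y. real (card (t y)) powr (1 - c)) * (1 + (1 - c) * (2 * K * sqrt \<gamma>)) ^ card Y"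
        by (simp add: prod.distrib)
      \<comment> \<open>The sizes of the sets \<open>t y\<close> are controlled by \<open>E\<close>,
        because the box lies in \<open>S\<close>. The small values are absorbed by
        \<open>1 + u \<le> exp u\<close> and the choice of \<open>\<gamma>\<close>.\<close>
      also have "\<dots> \<le> exp ((1 - c) * E) * exp ((1 - c) * \<eta>)"
      proof (rule mult_mono)
        have "(\<Prod>y\<in>Y. real (card (t y)) powr (1 - c)) = real (\<Prod>y\<in>Y. card (t y)) powr (1 - c)"
          by (simp flip: prod_powr_distrib)
        also have "\<dots> \<le> exp E powr (1 - c)"
          using E[OF t True] c by (intro powr_mono2) (auto intro: prod_nonneg)
        finally show "(\<Prod>y\<in>Y. real (card (t y)) powr (1 - c)) \<le> exp ((1 - c) * E)"
          by (simp add: powr_def)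
        have "(1 + (1 - c) * (2 * K * sqrt \<gamma>)) ^ card Y \<le> exp ((1 - c) * (2 * K * sqrt \<gamma>)) ^ card Y"
          using c K \<gamma> by (intro power_mono exp_ge_add_one_self) auto
        also have "\<dots> = exp ((1 - c) * (M * (2 * K * sqrt \<gamma>)))"
          by (simp add: M_def exp_of_nat_mult[symmetric] mult_ac)
        also have "\<dots> \<le> exp ((1 - c) * \<eta>)"
          using \<gamma>\<eta> c by (simp add: mult_left_mono)
        finally show "(1 + (1 - c) * (2 * K * sqrt \<gamma>)) ^ card Y \<le> exp ((1 - c) * \<eta>)" .
      qed (use c K \<gamma> in auto)
      finally show ?thesis
        by (simp add: exp_add[symmetric] algebra_simps)
    next
      case False
      then obtain \<omega>0 where \<omega>0: "\<omega>0 \<in> PiE Y t" "\<omega>0 \<notin> S" by blast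
      have finPi: "finite (Y \<rightarrow>\<^sub>E A)" using A Y by (simp add: finite_PiE)
      have \<omega>A: "\<omega>0 \<in> Y \<rightarrow>\<^sub>E A"
        using \<omega>0 by (auto simp: t_def PiE_iff)
      have big: "f y (\<omega>0 y) \<ge> \<gamma>" if "y \<in> Y" for y
        using \<omega>0 that by (auto simp: t_def PiE_iff)
      have le1: "f y a \<le> 1" if "y \<in> Y" "a \<in> A" for y a
        using f1[OF that(1)] f0[OF that(1)] that A member_le_sum[of a A "f y"] by auto
      have "\<gamma> ^ card Y \<le> (\<Prod>y\<in>Y. f y (\<omega>0 y) powr c)"
      proof -
        have "\<gamma> \<le> f y (\<omega>0 y) powr c" if y: "y \<in> Y" for y
        proof -
          have "\<omega>0 y \<in> A" using \<omega>A y by auto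
          have "\<gamma> \<le> f y (\<omega>0 y) powr 1" using big[OF y] \<gamma> by simp
          also have "\<dots> \<le> f y (\<omega>0 y) powr c"
            using le1[OF y \<open>\<omega>0 y \<in> A\<close>] f0[OF y \<open>\<omega>0 y \<in> A\<close>] c by (intro powr_mono') auto
          finally show ?thesis .
        qed
        then have "(\<Prod>y\<in>Y. \<gamma>) \<le> (\<Prod>y\<in>Y. f y (\<omega>0 y) powr c)"
          using \<gamma> by (intro prod_mono) auto
        then show ?thesis by simp
      qed
      \<comment> \<open>The missing point and \<open>S\<close> fit together into the full product,
        whose sum is at most \<open>1 + \<gamma> ^ card Y\<close> by \<open>loss\<close>. Removing
        the missing point leaves at most 1.\<close>
      moreover have "(\<Prod>y\<in>Y. f y (\<omega>0 y) powr c) + (\<Sum>\<omega>\<in>S. \<Prod>y\<in>Y. f y (\<omega> y) powr c)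
          = (\<Sum>\<omega>\<in>insert \<omega>0 S. \<Prod>y\<in>Y. f y (\<omega> y) powr c)"
        using \<omega>0 finite_subset[OF S finPi] by simp
      moreover have "\<dots> \<le> (\<Sum>\<omega>\<in>Y \<rightarrow>\<^sub>E A. \<Prod>y\<in>Y. f y (\<omega> y) powr c)"
        using S finPi \<omega>A by (intro sum_mono2) (auto intro!: prod_nonneg)
      moreover have "\<dots> = (\<Prod>y\<in>Y. \<Sum>a\<in>A. f y a powr c)"
        using A Y by (simp add: prod_sum_PiE)
      moreover have "\<dots> \<le> (\<Prod>y\<in>Y. K powr (1 - c))"
      proof (rule prod_mono, intro conjI)
        fix y assume y: "y \<in> Y"
        show "(\<Sum>a\<in>A. f y a powr c) \<le> K powr (1 - c)"
          using sum_powr_le[of A "f y" c 0 A] A f0[OF y] f1[OF y] c by (simp add: K_def)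
      qed (auto intro: sum_nonneg)
      ultimately have "(\<Sum>\<omega>\<in>S. \<Prod>y\<in>Y. f y (\<omega> y) powr c) \<le> 1"
        using loss by linarith
      \<comment> \<open>This is where \<open>E0\<close> enters.\<close>
      also have "1 \<le> exp ((1 - c) * (E + \<eta>))"
        using c E0 \<eta> by simp
      finally show ?thesis .
    qed
  qed
qed

text \<open>Both sides are homogeneous of degree \<open>c\<close> in each \<open>f y\<close>, so
  each \<open>f y\<close> may be divided by its total. If some total vanishes, every product on the
  left has a zero factor.\<close>

lemma weighted_count_le:
  fixes A :: "'a set" and Y :: "'y set" and S :: "('y \<Rightarrow> 'a) set" and E \<eta> :: real
  assumes A: "finite A" "A \<noteq> {}" and Y: "finite Y" and S: "S \<subseteq> (Y \<rightarrow>\<^sub>E A)"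
    and E0: "E \<ge> 0"
    and E: "\<And>t. t \<in> Y \<rightarrow>\<^sub>E (Pow A - {{}}) \<Longrightarrow> PiE Y t \<subseteq> S \<Longrightarrow> real (\<Prod>y\<in>Y. card (t y)) \<le> exp E"
    and \<eta>: "\<eta> > 0"
  obtains c where "0 < c" "c < 1"
    "\<And>f. (\<And>y a. y \<in> Y \<Longrightarrow> a \<in> A \<Longrightarrow> f y a \<ge> (0 :: real)) \<Longrightarrow>
      (\<Sum>\<omega>\<in>S. \<Prod>y\<in>Y. f y (\<omega> y) powr c)
        \<le> exp ((1 - c) * (E + \<eta>)) * (\<Prod>y\<in>Y. (\<Sum>a\<in>A. f y a) powr c)"
proof -
  show ?thesis
  proof (rule weighted_count_le_normalised[OF A Y S E0 E \<eta>])
    fix c :: real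
    assume c: "0 < c" "c < 1"
      and le: "\<And>f. (\<And>y a. y \<in> Y \<Longrightarrow> a \<in> A \<Longrightarrow> f y a \<ge> (0 :: real)) \<Longrightarrow> (\<And>y. y \<in> Y \<Longrightarrow> (\<Sum>a\<in>A. f y a) = 1) \<Longrightarrow>
        (\<Sum>\<omega>\<in>S. \<Prod>y\<in>Y. f y (\<omega> y) powr c) \<le> exp ((1 - c) * (E + \<eta>))"
    show thesis
    proof (rule that[OF c])
      fix f :: "'y \<Rightarrow> 'a \<Rightarrow> real"
      assume f0: "\<And>y a. y \<in> Y \<Longrightarrow> a \<in> A \<Longrightarrow> f y a \<ge> 0"
      define s where "s y = (\<Sum>a\<in>A. f y a)" for y
      have s0: "s y \<ge> 0" if "y \<in> Y" for y
        unfolding s_def using f0[OF that] by (rule sum_nonneg)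
      show "(\<Sum>\<omega>\<in>S. \<Prod>y\<in>Y. f y (\<omega> y) powr c)
          \<le> exp ((1 - c) * (E + \<eta>)) * (\<Prod>y\<in>Y. (\<Sum>a\<in>A. f y a) powr c)"
      proof (cases "\<exists>y\<in>Y. s y = 0")
        case True
        then obtain y where y: "y \<in> Y" "s y = 0" by blast
        then have "f y a = 0" if "a \<in> A" for a
          using that A f0[OF y(1)] by (simp add: s_def sum_nonneg_eq_0_iff)
        then have "(\<Prod>y\<in>Y. f y (\<omega> y) powr c) = 0" if "\<omega> \<in> S" for \<omega>
          using S that y Y by (auto simp: prod_zero_iff intro!: bexI[of _ y])
        then have "(\<Sum>\<omega>\<in>S. \<Prod>y\<in>Y. f y (\<omega> y) powr c) = 0"
          by simp
        then show ?thesis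
          by (simp add: prod_nonneg)
      next
        case False
        then have s: "s y > 0" if "y \<in> Y" for y
          using s0[OF that] that by force
        have "(\<Sum>\<omega>\<in>S. \<Prod>y\<in>Y. f y (\<omega> y) powr c)
            = (\<Prod>y\<in>Y. s y powr c) * (\<Sum>\<omega>\<in>S. \<Prod>y\<in>Y. (f y (\<omega> y) / s y) powr c)"
          unfolding sum_distrib_left prod.distrib[symmetric]
          by (intro sum.cong prod.cong refl) (use s in \<open>force simp flip: powr_mult\<close>)
        also have "\<dots> \<le> (\<Prod>y\<in>Y. s y powr c) * exp ((1 - c) * (E + \<eta>))"
        proof (intro mult_left_mono le)
          fix y assume y: "y \<in> Y"
          show "f y a / s y \<ge> 0" if "a \<in> A" for a
            using f0[OF y that] s0[OF y] by simp
          show "(\<Sum>a\<in>A. f y a / s y) = 1"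
            using s[OF y] by (simp add: s_def flip: sum_divide_distrib)
        qed (auto intro: prod_nonneg)
        finally show ?thesis
          by (simp add: s_def mult.commute)
      qed
    qed
  qed
qed

section \<open>Tensorisation over independent copies\<close>

text \<open>A family \<open>w\<close> is an array with one row in \<open>S\<close> for each
  \<open>x\<close>, while the weights \<open>g y\<close> see its columns. The induction adds one row
  at a time: the local inequality sums out the new row, and the induction hypothesis is applied to
  the resulting marginal weights, which is why \<open>g\<close> is generalised.\<close>

lemma weighted_count_tensorise:
  fixes A :: "'a set" and Y :: "'y set" and S :: "('y \<Rightarrow> 'a) set" and X :: "'x set" and B c :: real
  assumes A: "finite A" and X: "finite X" and S: "S \<subseteq> (Y \<rightarrow>\<^sub>E A)" "finite S" and B: "B \<ge> 0"
    and local: "\<And>f. (\<And>y a. y \<in> Y \<Longrightarrow> a \<in> A \<Longrightarrow> f y a \<ge> (0 :: real)) \<Longrightarrow>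
      (\<Sum>\<omega>\<in>S. \<Prod>y\<in>Y. f y (\<omega> y) powr c) \<le> B * (\<Prod>y\<in>Y. (\<Sum>a\<in>A. f y a) powr c)"
    and g: "\<And>y v. y \<in> Y \<Longrightarrow> v \<in> X \<rightarrow>\<^sub>E A \<Longrightarrow> g y v \<ge> 0"
  shows "(\<Sum>w\<in>X \<rightarrow>\<^sub>E S. \<Prod>y\<in>Y. g y (\<lambda>x\<in>X. w x y) powr c)
    \<le> B ^ card X * (\<Prod>y\<in>Y. (\<Sum>v\<in>X \<rightarrow>\<^sub>E A. g y v) powr c)"
  using X g
proof (induction X arbitrary: g rule: finite_induct)
  case empty
  then show ?case by simp
next
  case (insert x X)
  \<comment> \<open>Used with \<open>D = S\<close> for the rows and with \<open>D = A\<close> for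
    the columns.\<close>
  have split: "(\<Sum>v\<in>insert x X \<rightarrow>\<^sub>E D. h v) = (\<Sum>v\<in>X \<rightarrow>\<^sub>E D. \<Sum>a\<in>D. h (v(x := a)))"
    for D :: "'d set" and h :: "_ \<Rightarrow> real"
  proof -
    have "(\<Sum>v\<in>insert x X \<rightarrow>\<^sub>E D. h v) = (\<Sum>(a, v)\<in>D \<times> (X \<rightarrow>\<^sub>E D). h (v(x := a)))"
      using inj_combinator[OF insert(2), of "\<lambda>_. D"]
      by (simp add: PiE_insert_eq sum.reindex case_prod_unfold)
    also have "\<dots> = (\<Sum>a\<in>D. \<Sum>v\<in>X \<rightarrow>\<^sub>E D. h (v(x := a)))"
      by (rule sum.cartesian_product[symmetric])
    also have "\<dots> = (\<Sum>v\<in>X \<rightarrow>\<^sub>E D. \<Sum>a\<in>D. h (v(x := a)))"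
      by (rule sum.swap)
    finally show ?thesis .
  qed
  have "(\<Sum>w\<in>insert x X \<rightarrow>\<^sub>E S. \<Prod>y\<in>Y. g y (\<lambda>z\<in>insert x X. w z y) powr c)
      = (\<Sum>w\<in>X \<rightarrow>\<^sub>E S. \<Sum>\<omega>\<in>S. \<Prod>y\<in>Y. g y ((\<lambda>z\<in>X. w z y)(x := \<omega> y)) powr c)"
    unfolding split
    by (intro sum.cong prod.cong refl arg_cong2[where f = "(powr)"] arg_cong2[where f = g])
      (use insert(2) in auto)
  \<comment> \<open>With the old rows \<open>w\<close> fixed, the local inequality applies to the
    weights of the new entry \<open>a\<close> in column \<open>y\<close>.\<close>
  also have "\<dots> \<le> (\<Sum>w\<in>X \<rightarrow>\<^sub>E S. B * (\<Prod>y\<in>Y. (\<Sum>a\<in>A. g y ((\<lambda>z\<in>X. w z y)(x := a))) powr c))"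
  proof (intro sum_mono local)
    fix w y a assume *: "w \<in> X \<rightarrow>\<^sub>E S" "y \<in> Y" "a \<in> A"
    then have "w z y \<in> A" if "z \<in> X" for z
      using S that by (metis PiE_mem subsetD)
    then show "g y ((\<lambda>z\<in>X. w z y)(x := a)) \<ge> 0"
      using * by (intro insert.prems) (auto simp: PiE_iff extensional_def)
  qed
  also have "\<dots> = B * (\<Sum>w\<in>X \<rightarrow>\<^sub>E S. \<Prod>y\<in>Y. (\<lambda>v. \<Sum>a\<in>A. g y (v(x := a))) (\<lambda>z\<in>X. w z y) powr c)"
    by (simp add: sum_distrib_left)
  also have "\<dots> \<le> B * (B ^ card X * (\<Prod>y\<in>Y. (\<Sum>v\<in>X \<rightarrow>\<^sub>E A. \<Sum>a\<in>A. g y (v(x := a))) powr c))"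
    by (intro mult_left_mono B insert.IH sum_nonneg insert.prems) (auto simp: PiE_iff extensional_def)
  finally show ?case
    unfolding split using insert(1,2) by (simp add: mult_ac)
qed

section \<open>Cubes, templates and the splitting of coordinates\<close>

lemma finite_cube: "finite (cube n)"
  by (simp add: cube_def finite_PiE)

lemma card_cube: "card (cube n) = 2 ^ n"
  by (simp add: cube_def card_PiE numeral_2_eq_2)

lemma finite_colourings: "finite (colourings k n)"
  by (simp add: colourings_def finite_PiE finite_cube)

lemma finite_templates: "finite (templates k n)"
  by (simp add: templates_def finite_PiE finite_cube)

lemma realisations_eq_PiE:
  assumes "t \<in> templates k n"
  shows "realisations k n t = PiE (cube n) t"
proof (intro equalityI subsetI)
  show "c \<in> PiE (cube n) t" if "c \<in> realisations k n t" for c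
    using that by (simp add: realisations_def colourings_def PiE_iff)
next
  have "PiE (cube n) t \<subseteq> colourings k n"
    unfolding colourings_def using assms by (intro PiE_mono) (auto simp: templates_def PiE_iff)
  then show "c \<in> realisations k n t" if "c \<in> PiE (cube n) t" for c
    using that by (auto simp: realisations_def)
qed

text \<open>Turns entropy into the logarithm of the number of realisations, the form in which
  templates meet both \<open>card (P n)\<close> and the weighted inequality.\<close>

lemma Ent_eq:
  assumes t: "t \<in> templates k n" and k: "k \<ge> 2"
  shows "Ent k n t = log k (\<Prod>x\<in>cube n. card (t x))"
    and "(\<Prod>x\<in>cube n. card (t x)) > 0"
proof -
  have pos: "card (t x) > 0" if "x \<in> cube n" for x
  proof -
    have "t x \<subseteq> {1..k}" "t x \<noteq> {}"
      using t that by (auto simp: templates_def PiE_iff)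
    then show ?thesis
      using finite_subset by (fastforce simp: card_gt_0_iff)
  qed
  then show "(\<Prod>x\<in>cube n. card (t x)) > 0"
    by (simp add: prod_pos)
  show "Ent k n t = log k (\<Prod>x\<in>cube n. card (t x))"
    unfolding Ent_def log_def of_nat_prod using pos
    by (subst ln_prod) (auto simp: finite_cube sum_divide_distrib)
qed

text \<open>Identifies the cube of dimension \<open>n + m\<close> with a product of two cubes. The
  coordinates are kept in consecutive blocks, so that fixing either argument gives an
  order-preserving embedding in the other.\<close>

definition join :: "nat \<Rightarrow> nat \<Rightarrow> (nat \<Rightarrow> nat) \<Rightarrow> (nat \<Rightarrow> nat) \<Rightarrow> nat \<Rightarrow> nat" where
  "join n m x y = (\<lambda>i\<in>{1..n + m}. if i \<le> n then x i else y (i - n))"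

lemma join_in_cube:
  assumes "x \<in> cube n" "y \<in> cube m"
  shows "join n m x y \<in> cube (n + m)"
proof -
  have "x i \<in> {0, 1}" if "i \<in> {1..n}" for i
    using assms(1) that by (auto simp: cube_def PiE_iff)
  moreover have "y (i - n) \<in> {0, 1}" if "n < i" "i \<le> n + m" for i
  proof -
    have "i - n \<in> {1..m}" using that by auto
    then show ?thesis using assms(2) unfolding cube_def by (rule PiE_mem[rotated])
  qed
  ultimately show ?thesis
    unfolding cube_def join_def by (intro restrict_PiE_iff[THEN iffD2] ballI) auto
qed

lemma join_surj:
  assumes "z \<in> cube (n + m)"
  obtains x y where "x \<in> cube n" "y \<in> cube m" "z = join n m x y"
proof
  show "(\<lambda>i\<in>{1..n}. z i) \<in> cube n" "(\<lambda>i\<in>{1..m}. z (i + n)) \<in> cube m"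
    using assms by (auto simp: cube_def PiE_iff)
  show "z = join n m (\<lambda>i\<in>{1..n}. z i) (\<lambda>i\<in>{1..m}. z (i + n))"
    using assms by (auto simp: cube_def PiE_iff join_def extensional_def fun_eq_iff)
qed

lemma order_preserving_embedding_join_right:
  assumes x: "x \<in> cube n"
  shows "order_preserving_embedding m (n + m) (join n m x)"
  unfolding order_preserving_embedding_def
proof (intro conjI exI[of _ "\<lambda>j. n + j"] ballI)
  show "join n m x \<in> cube m \<rightarrow> cube (n + m)"
    using x by (simp add: join_in_cube)
  show "strict_mono_on {1..m} (\<lambda>j. n + j)"
    by (auto intro: strict_mono_onI)
  show "(\<lambda>j. n + j) ` {1..m} \<subseteq> {1..n + m}"
    by auto
next
  fix y j assume "y \<in> cube m" "j \<in> {1..m}"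
  then show "join n m x y (n + j) = y j"
    by (auto simp: join_def)
next
  fix y i assume "i \<in> {1..n + m} - (\<lambda>j. n + j) ` {1..m}"
  moreover have "i \<in> (\<lambda>j. n + j) ` {1..m}" if "n < i" "i \<le> n + m"
    using that by (intro image_eqI[of _ _ "i - n"]) auto
  ultimately show "join n m x y i = join n m x (zero_vertex m) i"
    by (auto simp: join_def)
qed

lemma order_preserving_embedding_join_left:
  assumes y: "y \<in> cube m"
  shows "order_preserving_embedding n (n + m) (\<lambda>x. join n m x y)"
  unfolding order_preserving_embedding_def
proof (intro conjI exI[of _ "\<lambda>j. j"] ballI)
  show "(\<lambda>x. join n m x y) \<in> cube n \<rightarrow> cube (n + m)"
    using y by (simp add: join_in_cube)
qed (auto simp: join_def intro: strict_mono_onI)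

section \<open>Counting the colourings of a hereditary property\<close>

locale hereditary_property =
  fixes k :: nat and P :: "nat \<Rightarrow> ((nat \<Rightarrow> nat) \<Rightarrow> nat) set"
  assumes k: "k \<ge> 2" and her: "order_hereditary k P" and P_ne: "P n \<noteq> {}"
begin

lemma P_subset: "P n \<subseteq> cube n \<rightarrow>\<^sub>E {1..k}"
  using her by (auto simp: order_hereditary_def colourings_def)

lemma finite_P: "finite (P n)"
  using P_subset finite_colourings[of k n] unfolding colourings_def by (rule finite_subset)

lemma card_P_pos: "card (P n) > 0"
  using finite_P P_ne by (simp add: card_gt_0_iff)

lemma compose_in_P:
  "m \<le> n \<Longrightarrow> order_preserving_embedding m n \<phi> \<Longrightarrow> c \<in> P n \<Longrightarrow> compose (cube m) c \<phi> \<in> P m"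
  using her by (auto simp: order_hereditary_def)

text \<open>A colouring of the large cube is an array indexed by \<open>cube n\<close> and
  \<open>cube m\<close>, with slices in \<open>P m\<close> one way and in \<open>P n\<close> the
  other. Tensorising gives one factor \<open>B\<close> for each vertex of \<open>cube n\<close>, and
  one factor \<open>card (P n) powr c\<close> for each vertex of \<open>cube m\<close>.\<close>

lemma card_P_add_le:
  fixes B c :: real
  assumes B: "B \<ge> 0"
    and local: "\<And>f. (\<And>y a. y \<in> cube m \<Longrightarrow> a \<in> {1..k} \<Longrightarrow> f y a \<ge> (0 :: real)) \<Longrightarrow>
      (\<Sum>\<omega>\<in>P m. \<Prod>y\<in>cube m. f y (\<omega> y) powr c) \<le> B * (\<Prod>y\<in>cube m. (\<Sum>a\<in>{1..k}. f y a) powr c)"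
  shows "real (card (P (n + m))) \<le> B ^ (2 ^ n) * real (card (P n)) powr (c * 2 ^ m)"
proof -
  define \<Psi> where "\<Psi> = (\<lambda>d. \<lambda>x\<in>cube n. \<lambda>y\<in>cube m. d (join n m x y) :: nat)"
  define g where "g = (\<lambda>(_ :: nat \<Rightarrow> nat) v. if v \<in> P n then 1 else 0 :: real)"
  have inj: "inj_on \<Psi> (P (n + m))"
  proof (rule inj_onI)
    fix d d' assume d: "d \<in> P (n + m)" "d' \<in> P (n + m)" and eq: "\<Psi> d = \<Psi> d'"
    show "d = d'"
    proof (rule PiE_ext[of _ "cube (n + m)"])
      show "d \<in> cube (n + m) \<rightarrow>\<^sub>E {1..k}" "d' \<in> cube (n + m) \<rightarrow>\<^sub>E {1..k}"
        using d P_subset by auto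
    next
      fix z assume "z \<in> cube (n + m)"
      then obtain x y where xy: "x \<in> cube n" "y \<in> cube m" "z = join n m x y"
        by (rule join_surj)
      then show "d z = d' z"
        using fun_cong[OF fun_cong[OF eq, of x], of y] by (simp add: \<Psi>_def)
    qed
  qed
  have rows: "(\<lambda>x\<in>cube n. \<Psi> d x y) \<in> P n" if "d \<in> P (n + m)" "y \<in> cube m" for d y
  proof -
    have "(\<lambda>x\<in>cube n. \<Psi> d x y) = compose (cube n) d (\<lambda>x. join n m x y)"
      using that by (auto simp: \<Psi>_def compose_def)
    then show ?thesis
      using compose_in_P[OF _ order_preserving_embedding_join_left] that by simp
  qed
  have cols: "\<Psi> d \<in> cube n \<rightarrow>\<^sub>E P m" if "d \<in> P (n + m)" for d
  proof -
    have "\<Psi> d x = compose (cube m) d (join n m x)" if "x \<in> cube n" for x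
      using that by (auto simp: \<Psi>_def compose_def)
    then have "\<Psi> d x \<in> P m" if "x \<in> cube n" for x
      using compose_in_P[OF _ order_preserving_embedding_join_right] that \<open>d \<in> P (n + m)\<close> by simp
    then show ?thesis
      by (auto simp: \<Psi>_def)
  qed
  \<comment> \<open>Every slice over \<open>cube n\<close> lies in \<open>P n\<close>, so all the
    indicators equal 1 and each colouring is counted exactly once.\<close>
  have "real (card (P (n + m))) = (\<Sum>d\<in>P (n + m). \<Prod>y\<in>cube m. g y (\<lambda>x\<in>cube n. \<Psi> d x y) powr c)"
    using rows by (simp add: g_def)
  also have "\<dots> = (\<Sum>w\<in>\<Psi> ` P (n + m). \<Prod>y\<in>cube m. g y (\<lambda>x\<in>cube n. w x y) powr c)"
    by (simp add: sum.reindex[OF inj])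
  also have "\<dots> \<le> (\<Sum>w\<in>cube n \<rightarrow>\<^sub>E P m. \<Prod>y\<in>cube m. g y (\<lambda>x\<in>cube n. w x y) powr c)"
    using cols by (intro sum_mono2) (auto simp: finite_PiE finite_cube finite_P intro!: prod_nonneg)
  also have "\<dots> \<le> B ^ card (cube n) * (\<Prod>y\<in>cube m. (\<Sum>v\<in>cube n \<rightarrow>\<^sub>E {1..k}. g y v) powr c)"
    by (intro weighted_count_tensorise P_subset finite_P finite_cube B local) (auto simp: g_def)
  also have "(\<lambda>y. \<Sum>v\<in>cube n \<rightarrow>\<^sub>E {1..k}. g y v) = (\<lambda>_. real (card (P n)))"
    using P_subset[of n] by (simp add: g_def finite_PiE finite_cube sum.If_cases Int_absorb1)
  also have "(\<Prod>y\<in>cube m. real (card (P n)) powr c) = real (card (P n)) powr (c * 2 ^ m)"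
    by (simp add: card_cube powr_powr[symmetric] powr_realpow[symmetric] card_P_pos)
  finally show ?thesis
    by (simp add: card_cube)
qed

section \<open>The normalised logarithmic count and its limit\<close>

definition density :: "nat \<Rightarrow> real" where
  "density n = log k (card (P n)) / 2 ^ n"

lemma density_nonneg: "density n \<ge> 0"
  using k card_P_pos[of n] by (simp add: density_def Suc_le_eq)

lemma log_card_P: "log k (card (P n)) = density n * 2 ^ n"
  by (simp add: density_def)

text \<open>Logarithm of \<open>card_P_add_le\<close>, divided by \<open>2 ^ (n + m)\<close>.
  Writing the constant as \<open>exp (ln k * F)\<close> measures \<open>F\<close> in base
  \<open>k\<close>, the unit of \<open>Ent\<close>.\<close>

lemma density_add_le:
  fixes F c :: real
  assumes local: "\<And>f. (\<And>y a. y \<in> cube m \<Longrightarrow> a \<in> {1..k} \<Longrightarrow> f y a \<ge> (0 :: real)) \<Longrightarrow>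
      (\<Sum>\<omega>\<in>P m. \<Prod>y\<in>cube m. f y (\<omega> y) powr c)
        \<le> exp (ln k * F) * (\<Prod>y\<in>cube m. (\<Sum>a\<in>{1..k}. f y a) powr c)"
  shows "density (n + m) \<le> F / 2 ^ m + c * density n"
proof -
  have lnk: "ln k > 0" using k by simp
  have "ln (card (P (n + m))) \<le> ln (exp (ln k * F) ^ (2 ^ n) * real (card (P n)) powr (c * 2 ^ m))"
    using card_P_add_le[OF _ local, of n] card_P_pos[of "n + m"] by (subst ln_le_cancel_iff) (auto simp: card_P_pos)
  also have "\<dots> = 2 ^ n * (ln k * F) + c * 2 ^ m * ln (card (P n))"
    using card_P_pos[of n] by (simp add: ln_mult ln_realpow ln_powr)
  finally have "log k (card (P (n + m))) \<le> (2 ^ n * (ln k * F) + c * 2 ^ m * ln (card (P n))) / ln k"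
    using lnk by (simp add: log_def divide_right_mono)
  also have "\<dots> = 2 ^ n * F + c * 2 ^ m * log k (card (P n))"
    using lnk by (simp add: log_def add_divide_distrib)
  finally have "density (n + m) * (2 ^ n * 2 ^ m) \<le> (F / 2 ^ m + c * density n) * (2 ^ n * 2 ^ m)"
    unfolding log_card_P by (simp add: power_add algebra_simps)
  then show ?thesis
    by (rule mult_right_le_imp_le) simp
qed

text \<open>The case \<open>m = 1\<close>, \<open>c = 1\<close>, \<open>F = 0\<close> of the
  recursion, where the local inequality only says that a sum over \<open>P 1\<close> is at most the
  sum over all colourings. It amounts to a colouring being determined by its two halves.\<close>

lemma decseq_density: "decseq density"
proof (rule decseq_SucI)
  fix n
  have "density (n + 1) \<le> 0 / 2 ^ 1 + 1 * density n"
  proof (rule density_add_le)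
    fix f :: "(nat \<Rightarrow> nat) \<Rightarrow> nat \<Rightarrow> real"
    assume f: "\<And>y a. y \<in> cube 1 \<Longrightarrow> a \<in> {1..k} \<Longrightarrow> f y a \<ge> 0"
    have "(\<Sum>\<omega>\<in>P 1. \<Prod>y\<in>cube 1. f y (\<omega> y) powr 1)
        = (\<Sum>\<omega>\<in>P 1. \<Prod>y\<in>cube 1. f y (\<omega> y))"
      using f P_subset[of 1] by (intro sum.cong prod.cong refl powr_one) (auto simp: PiE_iff)
    also have "\<dots> \<le> (\<Sum>\<omega>\<in>cube 1 \<rightarrow>\<^sub>E {1..k}. \<Prod>y\<in>cube 1. f y (\<omega> y))"
      using P_subset[of 1] f
      by (intro sum_mono2) (auto simp: finite_PiE finite_cube PiE_iff intro!: prod_nonneg)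
    also have "\<dots> = (\<Prod>y\<in>cube 1. \<Sum>a\<in>{1..k}. f y a)"
      by (simp add: prod_sum_PiE finite_cube)
    also have "\<dots> = (\<Prod>y\<in>cube 1. (\<Sum>a\<in>{1..k}. f y a) powr 1)"
      using f by (intro prod.cong refl powr_one[symmetric] sum_nonneg)
    finally show "(\<Sum>\<omega>\<in>P 1. \<Prod>y\<in>cube 1. f y (\<omega> y) powr 1)
      \<le> exp (ln k * 0) * (\<Prod>y\<in>cube 1. (\<Sum>a\<in>{1..k}. f y a) powr 1)"
      by simp
  qed
  then show "density (Suc n) \<le> density n" by simp
qed

lemma finite_Ents: "finite {Ent k n t | t. t \<in> templates k n \<and> realisations k n t \<subseteq> P n}"
  using finite_templates by simp

lemma Ent_le_exQ:
  assumes "t \<in> templates k n" "realisations k n t \<subseteq> P n"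
  shows "Ent k n t \<le> exQ k P n"
  unfolding exQ_def using assms by (intro Max_ge finite_Ents) auto

text \<open>Singleton sets around one colouring in \<open>P n\<close> form a template whose only
  realisation is that colouring. Hence the maximum defining \<open>exQ\<close> is over a nonempty
  set.\<close>

lemma exists_template: "\<exists>t. t \<in> templates k n \<and> realisations k n t \<subseteq> P n"
proof -
  obtain d where d: "d \<in> P n" using P_ne by blast
  then have dk: "d \<in> cube n \<rightarrow>\<^sub>E {1..k}" using P_subset by auto
  define t where "t = (\<lambda>x\<in>cube n. {d x})"
  have t: "t \<in> templates k n"
    using dk by (auto simp: t_def templates_def)
  have "e = d" if "e \<in> PiE (cube n) t" for e
    using that dk by (auto simp: t_def PiE_iff extensional_def fun_eq_iff)
  then show ?thesis
    using t d realisations_eq_PiE[OF t] by auto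
qed

lemma exQ_nonneg: "exQ k P n \<ge> 0"
proof -
  obtain t where t: "t \<in> templates k n" "realisations k n t \<subseteq> P n"
    using exists_template by blast
  have "0 \<le> Ent k n t"
    using Ent_eq[OF t(1) k] k by (simp add: Suc_le_eq del: of_nat_prod)
  then show ?thesis
    using Ent_le_exQ[OF t] by simp
qed

text \<open>The realisations of an optimal template all belong to \<open>P n\<close>, and the
  logarithm of their number is its entropy.\<close>

lemma exQ_le_density: "exQ k P n / 2 ^ n \<le> density n"
proof -
  have "exQ k P n \<in> {Ent k n t | t. t \<in> templates k n \<and> realisations k n t \<subseteq> P n}"
    unfolding exQ_def using exists_template by (intro Max_in finite_Ents) auto
  then obtain t where t: "t \<in> templates k n" "realisations k n t \<subseteq> P n" "exQ k P n = Ent k n t"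
    by auto
  have "(\<Prod>x\<in>cube n. card (t x)) = card (realisations k n t)"
    by (simp add: realisations_eq_PiE[OF t(1)] card_PiE finite_cube)
  also have "\<dots> \<le> card (P n)"
    using t(2) finite_P by (rule card_mono[rotated])
  finally have "Ent k n t \<le> log k (card (P n))"
    using Ent_eq[OF t(1) k] k card_P_pos[of n] by (simp del: of_nat_prod)
  then show ?thesis
    unfolding t(3) density_def by (rule divide_right_mono) simp
qed

text \<open>For fixed \<open>m\<close> and \<open>\<eta>\<close> the exponent \<open>c\<close> is
  independent of \<open>n\<close>, so the recursion can be passed to the limit in \<open>n\<close>.
  Then \<open>h\<close> stands on both sides, and since \<open>c < 1\<close> the common factor
  \<open>1 - c\<close> cancels however small it is.\<close>

lemma exQ_ge_limit:
  assumes h: "density \<longlonglongrightarrow> h"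
  shows "h \<le> exQ k P m / 2 ^ m"
proof (rule field_le_epsilon)
  fix \<eta> :: real assume \<eta>: "\<eta> > 0"
  have lnk: "ln k > 0" using k by simp
  \<comment> \<open>An error of \<open>\<eta>\<close> per vertex of \<open>cube m\<close> in base
    \<open>k\<close>, rewritten as a natural exponent.\<close>
  define \<eta>' where "\<eta>' = ln k * (\<eta> * 2 ^ m)"
  obtain c where c: "0 < c" "c < 1"
    and le: "\<And>f. (\<And>y a. y \<in> cube m \<Longrightarrow> a \<in> {1..k} \<Longrightarrow> f y a \<ge> (0 :: real)) \<Longrightarrow>
      (\<Sum>\<omega>\<in>P m. \<Prod>y\<in>cube m. f y (\<omega> y) powr c)
        \<le> exp ((1 - c) * (ln k * exQ k P m + \<eta>')) * (\<Prod>y\<in>cube m. (\<Sum>a\<in>{1..k}. f y a) powr c)"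
  proof (rule weighted_count_le[of "{1..k}" "cube m" "P m" "ln k * exQ k P m" \<eta>'])
    show "P m \<subseteq> cube m \<rightarrow>\<^sub>E {1..k}" by (rule P_subset)
    show "0 \<le> ln k * exQ k P m" using lnk exQ_nonneg by simp
    show "\<eta>' > 0" using lnk \<eta> by (simp add: \<eta>'_def)
  next
    fix t assume t: "t \<in> cube m \<rightarrow>\<^sub>E Pow {1..k} - {{}}" "PiE (cube m) t \<subseteq> P m"
    then have tt: "t \<in> templates k m" by (fastforce simp: templates_def PiE_iff)
    have "ln (real (\<Prod>y\<in>cube m. card (t y))) = ln k * Ent k m t"
      using lnk by (simp add: Ent_eq(1)[OF tt k] log_def del: of_nat_prod)
    also have "\<dots> \<le> ln k * exQ k P m"
      using Ent_le_exQ[OF tt] t(2) lnk by (simp add: realisations_eq_PiE[OF tt])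
    finally show "real (\<Prod>y\<in>cube m. card (t y)) \<le> exp (ln k * exQ k P m)"
      using Ent_eq(2)[OF tt k] by (metis exp_le_cancel_iff exp_ln of_nat_0_less_iff)
  qed (use k finite_cube in auto)
  have "(1 - c) * (ln k * exQ k P m + \<eta>') = ln k * ((1 - c) * (exQ k P m + \<eta> * 2 ^ m))"
    by (simp add: \<eta>'_def algebra_simps)
  note le = le[unfolded this]
  have "density (n + m) \<le> (1 - c) * (exQ k P m + \<eta> * 2 ^ m) / 2 ^ m + c * density n" for n
    by (rule density_add_le[OF le])
  moreover have "(\<lambda>n. density (n + m)) \<longlonglongrightarrow> h"
    using h by (rule LIMSEQ_ignore_initial_segment)
  moreover have "(\<lambda>n. (1 - c) * (exQ k P m + \<eta> * 2 ^ m) / 2 ^ m + c * density n)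
      \<longlonglongrightarrow> (1 - c) * (exQ k P m + \<eta> * 2 ^ m) / 2 ^ m + c * h"
    by (intro tendsto_intros h)
  ultimately have "h \<le> (1 - c) * (exQ k P m + \<eta> * 2 ^ m) / 2 ^ m + c * h"
    by (intro LIMSEQ_le) auto
  then have "(1 - c) * h \<le> (1 - c) * (exQ k P m / 2 ^ m + \<eta>)"
    by (simp add: field_simps)
  then show "h \<le> exQ k P m / 2 ^ m + \<eta>"
    using c by simp
qed

text \<open>The sequence \<open>exQ k P n / 2 ^ n\<close> is squeezed between the limit of
  \<open>density\<close> and \<open>density\<close> itself. This also proves that the limit defining
  \<open>entropy_density\<close> exists.\<close>

lemma density_tendsto: "density \<longlonglongrightarrow> entropy_density k P"
proof -
  obtain h where h: "density \<longlonglongrightarrow> h"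
    using decseq_convergent[OF decseq_density, of 0] density_nonneg by blast
  have "(\<lambda>n. exQ k P n / 2 ^ n) \<longlonglongrightarrow> h"
    using exQ_ge_limit[OF h] exQ_le_density by (intro tendsto_sandwich[OF _ _ tendsto_const h]) auto
  then show ?thesis
    using h by (simp add: entropy_density_def limI)
qed

end

theorem corollary3p24:
  fixes k :: nat and P :: "nat \<Rightarrow> ((nat \<Rightarrow> nat) \<Rightarrow> nat) set"
  assumes "k \<ge> 2"
    and "order_hereditary k P"
    and "\<And>n. P n \<noteq> {}"
  shows "\<exists>\<epsilon> :: nat \<Rightarrow> real. \<epsilon> \<in> o(\<lambda>_. 1) \<and>
    (\<forall>n. real (card (P n)) = real k powr ((entropy_density k P + \<epsilon> n) * 2 ^ n))"
proof -
  interpret hereditary_property k P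
    using assms by unfold_locales
  \<comment> \<open>With this error the formula is an exact identity for every \<open>n\<close>;
    only its convergence to 0 uses the limit.\<close>
  define \<epsilon> where "\<epsilon> n = density n - entropy_density k P" for n
  have "\<epsilon> \<longlonglongrightarrow> 0"
    unfolding \<epsilon>_def using density_tendsto by (rule LIM_zero)
  then have "\<epsilon> \<in> o(\<lambda>_. 1)"
    by (intro smalloI_tendsto) auto
  moreover have "real (card (P n)) = real k powr ((entropy_density k P + \<epsilon> n) * 2 ^ n)" for n
    using k card_P_pos[of n] by (simp add: \<epsilon>_def flip: log_card_P)
  ultimately show ?thesis by blast
qed

end
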